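(* Let $X$ be a centered, nondegenerate, infinitely divisible real random variable with finite variance $V>0$, and assume $\tau>0$. Then $c_*$ is continuous on $[V,\infty)$; in particular $\lim_{v\downarrow V}c_*(v)=c_*(V)$.
   Context: Standing setting: $X$ is a centered, nondegenerate, infinitely divisible real random variable with variance $0<V=\mathrm{Var}(X)<\infty$, Gaussian variance $a\ge0$ and Lévy measure $\nu$ on $\mathbb{R}\setminus\{0\}$. For all real $t$, $K_X(t)=\log\mathbb{E}e^{tX}=\frac{at^2}{2}+\int_{\mathbb{R}\setminus\{0\}}(e^{tx}-1-tx)\,\nu(dx)\in[0,\infty]$. $\tau=\sup\{t>0:K_X(t)<\infty\}\in[0,\infty]$ (with $\sup\emptyset=0$). A pair $(v,c)\in(0,\infty)\times[0,\infty)$ is feasible for $X$ if $K_X(t)\le \frac{vt^2}{2(1-ct)}$ for every $0\le t<1/c$ (with $1/0=\infty$; for $c=0$: for all $t\ge0$). $c_*(v)=\inf\{c\ge0:(v,c)\text{ is feasible}\}\in[0,\infty]$, with $\inf\emptyset=\infty$. *)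

theory Defs
  imports "HOL-Probability.Probability"
begin

definition infinitely_divisible :: "real measure \<Rightarrow> bool" where
  "infinitely_divisible D \<longleftrightarrow>
     (\<forall>n::nat. n \<ge> 1 \<longrightarrow>
        (\<exists>\<mu>. real_distribution \<mu> \<and>
             distr (PiM {..<n} (\<lambda>_. \<mu>)) borel (\<lambda>y. \<Sum>i<n. y i) = D))"

text \<open>A random variable is nondegenerate if it is not almost surely constant.\<close>

definition nondegenerate :: "'a measure \<Rightarrow> ('a \<Rightarrow> real) \<Rightarrow> bool" where
  "nondegenerate M X \<longleftrightarrow> \<not> (\<exists>b. AE \<omega> in M. X \<omega> = b)"

text \<open>The library integral of a non-integrable function is \<open>0\<close>, hence the case distinction:
  for a positive measurable integrand, non-integrable means that the expectation is \<open>\<infinity>\<close>.\<close>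

definition cumulant_gf :: "'a measure \<Rightarrow> ('a \<Rightarrow> real) \<Rightarrow> real \<Rightarrow> ereal" where
  "cumulant_gf M X t =
     (if integrable M (\<lambda>\<omega>. exp (t * X \<omega>))
      then ereal (ln (\<integral>\<omega>. exp (t * X \<omega>) \<partial>M)) else \<infinity>)"

text \<open>In \<open>ennreal\<close> the supremum of the empty set is \<open>0\<close> and its infimum is \<open>\<infinity>\<close>.\<close>

definition tau :: "'a measure \<Rightarrow> ('a \<Rightarrow> real) \<Rightarrow> ennreal" where
  "tau M X = (SUP t \<in> {t. 0 < t \<and> cumulant_gf M X t < \<infinity>}. ennreal t)"

definition feasible :: "'a measure \<Rightarrow> ('a \<Rightarrow> real) \<Rightarrow> real \<Rightarrow> real \<Rightarrow> bool" where
  "feasible M X v c \<longleftrightarrow> 0 < v \<and> 0 \<le> c \<and>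
     (\<forall>t\<ge>0. c = 0 \<or> t < 1 / c \<longrightarrow>
        cumulant_gf M X t \<le> ereal (v * t\<^sup>2 / (2 * (1 - c * t))))"

definition c_star :: "'a measure \<Rightarrow> ('a \<Rightarrow> real) \<Rightarrow> real \<Rightarrow> ennreal" where
  "c_star M X v = (INF c \<in> {c. feasible M X v c}. ennreal c)"

end

theory Submission
  imports Defs
begin

text \<open>
  Clearing the denominator in the definition of feasibility shows what drives the result. Write
  \<open>K\<close> for the cumulant generating function, which is nonnegative because \<open>X\<close> is centered. Where
  \<open>K t\<close> is finite, the condition at \<open>t\<close> reads \<open>K t * (1 - c * t) \<le> v * t\<^sup>2 / 2\<close>, and by
  nonnegativity of \<open>K t\<close> this holds by itself once \<open>c * t \<ge> 1\<close>, so that the side condition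
  \<open>t < 1 / c\<close> disappears. Where \<open>K t\<close> is infinite, the condition says \<open>c * t \<ge> 1\<close>. For each \<open>t\<close>
  the admissible pairs thus form a closed half-plane or, in degenerate cases such as \<open>t = 0\<close>, a
  trivial set. Together with \<open>c \<ge> 0\<close> these constraints cut out a closed convex region of the
  \<open>(v, c)\<close> plane, upward closed in both coordinates; over \<open>v > 0\<close> it consists of the feasible pairs
  (\<open>feasible_iff_region\<close>), and \<open>c_star\<close> is its lower boundary.

  The lower boundary of such a region is antimonotone and convex. Convexity gives continuity in
  the interior of \<open>[V, \<infinity>)\<close>; at the endpoint \<open>V\<close> the boundary cannot jump up because it is
  antimonotone, and cannot jump down to the right of \<open>V\<close> because the region is closed
  (\<open>continuous_on_lower_boundary\<close>).

  All this presupposes that some pair \<open>(V, c)\<close> is feasible (\<open>ex_feasible_variance\<close>), and here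
  \<open>tau > 0\<close> enters. For small \<open>t > 0\<close>, the second-order Taylor expansion of \<open>exp (t * X)\<close> has an
  error that is negative where \<open>X < 0\<close>, so the left tail needs no exponential moment, and that is
  \<open>O(t\<^sup>3)\<close> times an integrable exponential where \<open>X \<ge> 0\<close>. Hence
  \<open>K t \<le> V * t\<^sup>2 / 2 + D * t\<^sup>3\<close>, which is at most \<open>V * t\<^sup>2 / (2 * (1 - c * t))\<close> for large \<open>c\<close>;
  and a large \<open>c\<close> makes the condition void for the other \<open>t\<close>.
\<close>

section \<open>Lower boundaries of closed convex planar regions\<close>

lemma continuous_on_lower_boundary:
  fixes G :: "(real \<times> real) set" and V :: real
  defines "f \<equiv> \<lambda>v. Inf {c. (v, c) \<in> G}"
  assumes closed: "closed G" and convex: "convex G"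
    and nonneg: "\<And>v c. (v, c) \<in> G \<Longrightarrow> 0 \<le> c"
    and up: "\<And>v w c d. (v, c) \<in> G \<Longrightarrow> v \<le> w \<Longrightarrow> c \<le> d \<Longrightarrow> (w, d) \<in> G"
    and ne: "(V, c0) \<in> G"
  shows "continuous_on {V..} f"
proof -
  have bdd: "bdd_below {c. (v, c) \<in> G}" for v
    using nonneg by (auto intro!: bdd_belowI)
  have lower: "f v \<le> c" if "(v, c) \<in> G" for v c
    unfolding f_def using bdd that by (intro cInf_lower) auto
  have attained: "(v, f v) \<in> G" if "V \<le> v" for v
  proof -
    have "closed (Pair v -` G)"
      by (intro closed_vimage[OF closed] continuous_intros)
    then have "closed {c. (v, c) \<in> G}"
      by (simp only: vimage_def)
    moreover have "{c. (v, c) \<in> G} \<noteq> {}"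
      using up[OF ne that order_refl] by blast
    ultimately have "Inf {c. (v, c) \<in> G} \<in> {c. (v, c) \<in> G}"
      using bdd by (intro closed_contains_Inf)
    then show ?thesis by (simp add: f_def)
  qed
  have anti: "f w \<le> f v" if "V \<le> v" "v \<le> w" for v w
    using attained that up lower by blast
  have "convex_on {V<..} f"
  proof (rule convex_onI)
    fix s x y :: real
    assume s: "0 < s" "s < 1" and xy: "x \<in> {V<..}" "y \<in> {V<..}"
    have "(1 - s) *\<^sub>R (x, f x) + s *\<^sub>R (y, f y) \<in> G"
      using xy s by (intro convexD[OF convex] attained) auto
    then show "f ((1 - s) *\<^sub>R x + s *\<^sub>R y) \<le> (1 - s) * f x + s * f y"
      by (intro lower) simp
  qed (rule convex_real_interval)
  then have interior: "continuous_on {V<..} f"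
    by (intro convex_on_continuous) auto
  have endpoint: "(f \<longlongrightarrow> f V) (at_right V)"
  proof (rule order_tendstoI)
    fix a assume "f V < a"
    then have "f w < a" if "V < w" for w
      using anti[OF order_refl less_imp_le[OF that]] by (rule le_less_trans[rotated])
    then show "\<forall>\<^sub>F w in at_right V. f w < a"
      using eventually_at_right_less by (rule eventually_mono[rotated])
  next
    fix a assume "a < f V"
    then have out: "(V, a) \<in> - G"
      using lower[of V a] by auto
    have "((\<lambda>w. (w, a)) \<longlongrightarrow> (V, a)) (at_right V)"
      by (intro tendsto_intros)
    then have "\<forall>\<^sub>F w in at_right V. (w, a) \<in> - G"
      using closed out by (intro topological_tendstoD) auto
    moreover have "\<forall>\<^sub>F w in at_right V. V < w"
      by (rule eventually_at_right_less)
    ultimately show "\<forall>\<^sub>F w in at_right V. a < f w"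
    proof eventually_elim
      case (elim w)
      show ?case
      proof (rule ccontr)
        assume "\<not> a < f w"
        then have "(w, a) \<in> G"
          using up[OF attained[of w]] elim(2) by simp
        then show False
          using elim(1) by simp
      qed
    qed
  qed
  show ?thesis
  proof (rule continuous_on_eq_continuous_within[THEN iffD2], rule ballI)
    fix v assume "v \<in> {V..}"
    then consider "v = V" | "v \<in> {V<..}" by force
    then show "continuous (at v within {V..}) f"
    proof cases
      case 1
      then show ?thesis
        using endpoint by (simp add: continuous_within at_within_Ici_at_right)
    next
      case 2
      then have "isCont f v"
        using interior continuous_on_eq_continuous_at[of "{V<..}" f] by simp
      then show ?thesis
        by (rule continuous_at_imp_continuous_at_within)
    qed
  qed
qed

section \<open>The feasible region\<close>

text \<open>The inequality at \<open>t\<close> after multiplication by \<open>1 - c * t\<close>. The value \<open>K t = \<infinity>\<close> needs its own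
  case, since it satisfies the original inequality for no \<open>t < 1 / c\<close>.\<close>

definition constraint_set :: "'a measure \<Rightarrow> ('a \<Rightarrow> real) \<Rightarrow> real \<Rightarrow> (real \<times> real) set" where
  "constraint_set M X t =
     (if integrable M (\<lambda>\<omega>. exp (t * X \<omega>))
      then {p. ln (\<integral>\<omega>. exp (t * X \<omega>) \<partial>M) * (1 - snd p * t) \<le> fst p * (t\<^sup>2 / 2)}
      else {p. 1 \<le> snd p * t})"

definition feasible_region :: "'a measure \<Rightarrow> ('a \<Rightarrow> real) \<Rightarrow> (real \<times> real) set" where
  "feasible_region M X = {p. 0 \<le> snd p} \<inter> (\<Inter>t\<in>{0..}. constraint_set M X t)"

lemma closed_feasible_region: "closed (feasible_region M X)"
  unfolding feasible_region_def constraint_set_def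
  by (intro closed_Int closed_INT ballI)
     (auto intro!: closed_Collect_le continuous_intros)

lemma convex_constraint_set: "convex (constraint_set M X t)"
proof -
  have halfplane: "convex {p :: real \<times> real. a \<le> b * fst p + d * snd p}" for a b d
    using convex_halfspace_ge[of a "(b, d)"] by (simp add: inner_prod_def)
  define k where "k = ln (\<integral>\<omega>. exp (t * X \<omega>) \<partial>M)"
  have finite_case: "{p. k * (1 - snd p * t) \<le> fst p * (t\<^sup>2 / 2)}
      = {p :: real \<times> real. k \<le> (t\<^sup>2 / 2) * fst p + (k * t) * snd p}"
    by (auto simp: algebra_simps)
  have infinite_case: "{p. 1 \<le> snd p * t} = {p :: real \<times> real. 1 \<le> 0 * fst p + t * snd p}"
    by (auto simp: algebra_simps)
  show ?thesis
    unfolding constraint_set_def k_def[symmetric] finite_case infinite_case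
    by (simp only: halfplane split: if_split) simp
qed

lemma convex_feasible_region: "convex (feasible_region M X)"
proof -
  have "convex {p :: real \<times> real. 0 \<le> snd p}"
    using convex_halfspace_ge[of 0 "(0 :: real, 1 :: real)"] by (simp add: inner_prod_def)
  then show ?thesis
    unfolding feasible_region_def
    by (intro convex_Int convex_INT convex_constraint_set)
qed

lemma (in prob_space) cumulant_nonneg:
  fixes X :: "'a \<Rightarrow> real"
  assumes "integrable M X" and "expectation X = 0"
    and "integrable M (\<lambda>\<omega>. exp (t * X \<omega>))"
  shows "0 \<le> ln (expectation (\<lambda>\<omega>. exp (t * X \<omega>)))"
proof -
  have "expectation (\<lambda>\<omega>. 1 + t * X \<omega>) \<le> expectation (\<lambda>\<omega>. exp (t * X \<omega>))"
    using assms by (intro integral_mono exp_ge_add_one_self) auto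
  moreover have "expectation (\<lambda>\<omega>. 1 + t * X \<omega>) = 1"
    using assms by (simp add: prob_space)
  ultimately show ?thesis
    by simp
qed

lemma (in prob_space) feasible_region_upward_closed:
  assumes X: "integrable M X" "expectation X = 0"
    and p: "(v, c) \<in> feasible_region M X" and le: "v \<le> w" "c \<le> d"
  shows "(w, d) \<in> feasible_region M X"
proof -
  have p_t: "(v, c) \<in> constraint_set M X t" if "0 \<le> t" for t
    using p that by (simp add: feasible_region_def)
  have "(w, d) \<in> constraint_set M X t" if t: "0 \<le> t" for t
  proof (cases "integrable M (\<lambda>\<omega>. exp (t * X \<omega>))")
    case True
    let ?k = "ln (expectation (\<lambda>\<omega>. exp (t * X \<omega>)))"
    have "?k * (1 - d * t) \<le> ?k * (1 - c * t)"
      using cumulant_nonneg[OF X True] le t by (intro mult_left_mono) (auto intro: mult_right_mono)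
    also have "\<dots> \<le> v * (t\<^sup>2 / 2)"
      using p_t[OF t] True by (simp add: constraint_set_def)
    also have "\<dots> \<le> w * (t\<^sup>2 / 2)"
      using le by (intro mult_right_mono) auto
    finally show ?thesis
      using True by (simp add: constraint_set_def)
  next
    case False
    have "1 \<le> c * t"
      using p_t[OF t] False by (simp add: constraint_set_def)
    also have "\<dots> \<le> d * t"
      using le t by (intro mult_right_mono)
    finally show ?thesis
      using False by (simp add: constraint_set_def)
  qed
  then show ?thesis
    using p le by (auto simp: feasible_region_def)
qed

text \<open>For \<open>c * t \<ge> 1\<close> feasibility demands nothing, and neither does the linearized inequality: its
  left-hand side is then nonpositive because centering makes \<open>K t\<close> nonnegative.\<close>

lemma (in prob_space) feasible_iff_region:
  assumes X: "integrable M X" "expectation X = 0" and "0 < v"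
  shows "feasible M X v c \<longleftrightarrow> (v, c) \<in> feasible_region M X"
proof (cases "0 \<le> c")
  case True
  have "(c = 0 \<or> t < 1 / c \<longrightarrow> cumulant_gf M X t \<le> ereal (v * t\<^sup>2 / (2 * (1 - c * t))))
      \<longleftrightarrow> (v, c) \<in> constraint_set M X t" if t: "0 \<le> t" for t
  proof -
    have range: "c = 0 \<or> t < 1 / c \<longleftrightarrow> c * t < 1"
      using True by (cases "c = 0") (simp_all add: pos_less_divide_eq mult.commute)
    show ?thesis
    proof (cases "integrable M (\<lambda>\<omega>. exp (t * X \<omega>))")
      case fin: True
      let ?k = "ln (expectation (\<lambda>\<omega>. exp (t * X \<omega>)))"
      show ?thesis
      proof (cases "c * t < 1")
        case True
        then have "?k \<le> v * t\<^sup>2 / (2 * (1 - c * t)) \<longleftrightarrow> ?k * (1 - c * t) \<le> v * (t\<^sup>2 / 2)"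
          by (subst pos_le_divide_eq) (auto simp: algebra_simps)
        then show ?thesis
          using range fin True by (simp add: cumulant_gf_def constraint_set_def)
      next
        case False
        then have "?k * (1 - c * t) \<le> 0"
          using cumulant_nonneg[OF X fin] by (intro mult_nonneg_nonpos) auto
        also have "0 \<le> v * (t\<^sup>2 / 2)"
          using \<open>0 < v\<close> by simp
        finally show ?thesis
          using range fin False by (simp add: constraint_set_def)
      qed
    next
      case False
      then show ?thesis
        using range by (auto simp: cumulant_gf_def constraint_set_def)
    qed
  qed
  then show ?thesis
    using True \<open>0 < v\<close> by (auto simp: feasible_def feasible_region_def)
qed (simp add: feasible_def feasible_region_def)

section \<open>Feasibility at the variance\<close>

text \<open>The Lagrange remainder has the sign of \<open>x\<close>, so an exponential is needed to dominate it only for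
  \<open>x \<ge> 0\<close>. Half of the exponent \<open>s\<close> pays for \<open>x ^ 3\<close>, the other half for \<open>exp (t * x)\<close>.\<close>

lemma exp_le_quadratic_plus_cubic:
  fixes s t x :: real
  assumes "0 < s" and "0 \<le> t" and "t \<le> s / 2"
  shows "exp (t * x) \<le> 1 + t * x + t\<^sup>2 * x\<^sup>2 / 2 + t ^ 3 * (8 / s ^ 3 * exp (s * x))"
proof -
  obtain \<xi> where \<xi>: "\<bar>\<xi>\<bar> \<le> \<bar>t * x\<bar>"
    and eq: "exp (t * x) = (\<Sum>m<3. (t * x) ^ m / fact m) + exp \<xi> / fact 3 * (t * x) ^ 3"
    using Maclaurin_exp_le by blast
  have taylor: "exp (t * x) = 1 + t * x + t\<^sup>2 * x\<^sup>2 / 2 + exp \<xi> / 6 * (t * x) ^ 3"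
    unfolding eq by (simp add: eval_nat_numeral field_simps)
  have "exp \<xi> / 6 * (t * x) ^ 3 \<le> t ^ 3 * (8 / s ^ 3 * exp (s * x))"
  proof (cases "0 \<le> x")
    case True
    let ?y = "s / 2 * x"
    have y: "0 \<le> ?y"
      using True assms by simp
    have "?y ^ 3 / 6 \<le> exp ?y"
    proof -
      have "?y ^ 3 / fact 3 \<le> (\<Sum>m<4. ?y ^ m / fact m)"
        using y by (intro member_le_sum[of 3 _ "\<lambda>m. ?y ^ m / fact m"]) auto
      also have "\<dots> \<le> exp ?y"
      proof -
        obtain \<eta> where "exp ?y = (\<Sum>m<4. ?y ^ m / fact m) + exp \<eta> / fact 4 * ?y ^ 4"
          using Maclaurin_exp_le by blast
        then show ?thesis by simp
      qed
      finally show ?thesis by (simp add: fact_numeral)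
    qed
    then have cube: "x ^ 3 / 6 \<le> 8 / s ^ 3 * exp ?y"
      using assms(1) by (simp add: power_mult_distrib field_simps)
    have "t * x \<le> ?y"
      using True assms by (intro mult_right_mono)
    moreover have "0 \<le> t * x"
      using True assms by simp
    ultimately have "exp \<xi> \<le> exp ?y"
      using \<xi> by simp
    then have "exp \<xi> / 6 * (t * x) ^ 3 \<le> exp ?y / 6 * (t * x) ^ 3"
      using True assms by (intro mult_right_mono divide_right_mono) auto
    also have "\<dots> = t ^ 3 * exp ?y * (x ^ 3 / 6)"
      by (simp add: power_mult_distrib)
    also have "\<dots> \<le> t ^ 3 * exp ?y * (8 / s ^ 3 * exp ?y)"
      using assms cube by (intro mult_left_mono) auto
    also have "\<dots> = t ^ 3 * (8 / s ^ 3 * exp (s * x))"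
      by (simp add: exp_add[symmetric])
    finally show ?thesis .
  next
    case False
    then have "(t * x) ^ 3 \<le> 0"
      using assms by (simp add: power_mult_distrib mult_nonneg_nonpos power_less_zero_eq_numeral)
    then have "exp \<xi> / 6 * (t * x) ^ 3 \<le> 0"
      by (intro mult_nonneg_nonpos) auto
    also have "0 \<le> t ^ 3 * (8 / s ^ 3 * exp (s * x))"
      using assms by simp
    finally show ?thesis .
  qed
  then show ?thesis
    using taylor by simp
qed

lemma (in prob_space) cumulant_le_quadratic_plus_cubic:
  fixes X :: "'a \<Rightarrow> real"
  assumes X: "integrable M X" "expectation X = 0" and X2: "integrable M (\<lambda>\<omega>. (X \<omega>)\<^sup>2)"
    and s: "0 < s" "integrable M (\<lambda>\<omega>. exp (s * X \<omega>))" and t: "0 \<le> t" "t \<le> s / 2"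
  shows "integrable M (\<lambda>\<omega>. exp (t * X \<omega>))"
    and "ln (expectation (\<lambda>\<omega>. exp (t * X \<omega>)))
      \<le> variance X * t\<^sup>2 / 2 + 8 / s ^ 3 * expectation (\<lambda>\<omega>. exp (s * X \<omega>)) * t ^ 3"
proof -
  let ?b = "\<lambda>\<omega>. 1 + t * X \<omega> + t\<^sup>2 * (X \<omega>)\<^sup>2 / 2 + t ^ 3 * (8 / s ^ 3 * exp (s * X \<omega>))"
  have b: "integrable M ?b"
    using X X2 s by (intro Bochner_Integration.integrable_add integrable_mult_right
      integrable_divide) auto
  have le: "exp (t * X \<omega>) \<le> ?b \<omega>" for \<omega>
    using s(1) t by (rule exp_le_quadratic_plus_cubic)
  show exp_int: "integrable M (\<lambda>\<omega>. exp (t * X \<omega>))"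
  proof (rule Bochner_Integration.integrable_bound[OF b])
    show "(\<lambda>\<omega>. exp (t * X \<omega>)) \<in> borel_measurable M"
      using borel_measurable_integrable[OF X(1)] by measurable
    show "AE \<omega> in M. norm (exp (t * X \<omega>)) \<le> norm (?b \<omega>)"
      using order_trans[OF le abs_ge_self] by (intro AE_I2) (simp only: real_norm_def abs_exp_cancel)
  qed
  let ?m = "expectation (\<lambda>\<omega>. exp (t * X \<omega>))"
  let ?u = "variance X * t\<^sup>2 / 2 + 8 / s ^ 3 * expectation (\<lambda>\<omega>. exp (s * X \<omega>)) * t ^ 3"
  have "?m \<le> expectation ?b"
    using exp_int b le by (rule integral_mono)
  also have "expectation ?b = 1 + ?u"
    using X X2 s by (simp add: prob_space mult.commute)
  finally have m_le: "?m \<le> 1 + ?u" .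
  have "0 < ?m"
  proof (rule ccontr)
    assume "\<not> 0 < ?m"
    moreover have "0 \<le> ?m" by simp
    ultimately have "?m = 0" by linarith
    then have "AE \<omega> in M. exp (t * X \<omega>) = 0"
      using integral_nonneg_eq_0_iff_AE[OF exp_int] by simp
    then show False
      by simp
  qed
  then have "ln ?m \<le> ?m - 1"
    by (rule ln_le_minus_one)
  then show "ln ?m \<le> ?u"
    using m_le by linarith
qed

text \<open>The slope \<open>c\<close> is at least \<open>2 / s\<close>, so that only \<open>t \<le> s / 2\<close> matters, and at least
  \<open>2 * D / V\<close>, so that \<open>V * t\<^sup>2 / 2 + D * t\<^sup>3 \<le> V * t\<^sup>2 / 2 * (1 + c * t)\<close>; the factor
  \<open>1 + c * t\<close> is at most \<open>1 / (1 - c * t)\<close>.\<close>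

lemma (in prob_space) ex_feasible_variance:
  fixes X :: "'a \<Rightarrow> real"
  assumes X: "integrable M X" "expectation X = 0" and X2: "integrable M (\<lambda>\<omega>. (X \<omega>)\<^sup>2)"
    and s: "0 < s" "integrable M (\<lambda>\<omega>. exp (s * X \<omega>))" and V: "0 < variance X"
  shows "\<exists>c. (variance X, c) \<in> feasible_region M X"
proof -
  define D where "D = 8 / s ^ 3 * expectation (\<lambda>\<omega>. exp (s * X \<omega>))"
  define c where "c = max (2 / s) (2 * D / variance X)"
  have c: "2 / s \<le> c" "2 * D / variance X \<le> c"
    by (auto simp: c_def)
  have c0: "0 < c"
    using c(1) s(1) by (intro less_le_trans[OF _ c(1)]) simp
  have "(variance X, c) \<in> constraint_set M X t" if t: "0 \<le> t" for t
  proof (cases "1 \<le> c * t")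
    case True
    show ?thesis
    proof (cases "integrable M (\<lambda>\<omega>. exp (t * X \<omega>))")
      case fin: True
      have "ln (expectation (\<lambda>\<omega>. exp (t * X \<omega>))) * (1 - c * t) \<le> 0"
        using cumulant_nonneg[OF X fin] True by (intro mult_nonneg_nonpos) auto
      also have "0 \<le> variance X * (t\<^sup>2 / 2)"
        using V by simp
      finally show ?thesis
        using fin by (simp add: constraint_set_def)
    qed (use True in \<open>simp add: constraint_set_def\<close>)
  next
    case False
    have "2 / s * t \<le> c * t"
      using c(1) t by (rule mult_right_mono)
    then have "2 / s * t < 1"
      using False by simp
    then have ts: "t \<le> s / 2"
      using s(1) by (simp add: field_simps)
    note K = cumulant_le_quadratic_plus_cubic[OF X X2 s t ts]
    have "D \<le> variance X / 2 * c"
      using c(2) V by (simp add: field_simps)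
    then have "D * t ^ 3 \<le> variance X / 2 * c * t ^ 3"
      using t by (intro mult_right_mono) auto
    then have "ln (expectation (\<lambda>\<omega>. exp (t * X \<omega>))) \<le> variance X * (t\<^sup>2 / 2) * (1 + c * t)"
      using K(2) unfolding D_def[symmetric] by (simp add: algebra_simps power2_eq_square power3_eq_cube)
    then have "ln (expectation (\<lambda>\<omega>. exp (t * X \<omega>))) * (1 - c * t)
        \<le> variance X * (t\<^sup>2 / 2) * (1 + c * t) * (1 - c * t)"
      using False by (intro mult_right_mono) auto
    also have "\<dots> = variance X * (t\<^sup>2 / 2) * (1 - (c * t)\<^sup>2)"
      by (simp add: algebra_simps power2_eq_square)
    also have "\<dots> \<le> variance X * (t\<^sup>2 / 2) * 1"
      using V by (intro mult_left_mono) auto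
    finally show ?thesis
      using K(1) by (simp add: constraint_set_def)
  qed
  then have "(variance X, c) \<in> feasible_region M X"
    using c0 by (auto simp: feasible_region_def)
  then show ?thesis ..
qed

section \<open>Continuity of the optimal slope\<close>

lemma INF_ennreal_eq_Inf:
  fixes A :: "real set"
  assumes "A \<noteq> {}" and "\<And>c. c \<in> A \<Longrightarrow> 0 \<le> c"
  shows "(INF c\<in>A. ennreal c) = ennreal (Inf A)"
proof -
  have bdd: "bdd_below A"
    using assms(2) by (rule bdd_belowI)
  have "continuous (at_right (Inf A)) ennreal"
    unfolding continuous_within by (intro tendsto_ennrealI tendsto_ident_at)
  then have "ennreal (Inf A) = (INF c\<in>A. ennreal c)"
    using assms(1) bdd by (intro continuous_at_Inf_mono) (auto intro!: monoI ennreal_leI)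
  then show ?thesis ..
qed

theorem proposition3p6:
  fixes M :: "'a measure" and X :: "'a \<Rightarrow> real" and V :: real
  assumes "prob_space M"
    and "X \<in> borel_measurable M"
    and "infinitely_divisible (distr M borel X)"
    and "nondegenerate M X"
    and "integrable M (\<lambda>\<omega>. (X \<omega>)\<^sup>2)"
    and "prob_space.expectation M X = 0"
    and "V = prob_space.variance M X"
    and "V > 0"
    and "tau M X > 0"
  shows "(\<forall>v\<ge>V. c_star M X v < \<infinity>) \<and>
         continuous_on {V..} (c_star M X) \<and>
         (c_star M X \<longlongrightarrow> c_star M X V) (at_right V)"
proof -
  interpret prob_space M by fact
  have X: "integrable M X" "expectation X = 0"
    using square_integrable_imp_integrable[OF assms(2,5)] assms(6) by auto
  let ?G = "feasible_region M X"
  have "\<exists>s>0. cumulant_gf M X s < \<infinity>"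
    using assms(9) by (auto simp: tau_def less_SUP_iff)
  then obtain s where s: "0 < s" "integrable M (\<lambda>\<omega>. exp (s * X \<omega>))"
    by (auto simp: cumulant_gf_def split: if_splits)
  have "0 < variance X"
    using assms(7,8) by simp
  then obtain c0 where c0: "(V, c0) \<in> ?G"
    using ex_feasible_variance[OF X assms(5) s] assms(7) by blast
  note up = feasible_region_upward_closed[OF X]
  have nonneg: "0 \<le> c" if "(v, c) \<in> ?G" for v c
    using that by (simp add: feasible_region_def)
  have c_star_eq: "c_star M X v = ennreal (Inf {c. (v, c) \<in> ?G})" if "V \<le> v" for v
  proof -
    have "{c. feasible M X v c} = {c. (v, c) \<in> ?G}"
      using feasible_iff_region[OF X] that assms(8) by auto
    moreover have "(INF c\<in>{c. (v, c) \<in> ?G}. ennreal c) = ennreal (Inf {c. (v, c) \<in> ?G})"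
      using up[OF c0 that order_refl] nonneg by (intro INF_ennreal_eq_Inf) auto
    ultimately show ?thesis
      by (simp only: c_star_def)
  qed
  have "continuous_on {V..} (\<lambda>v. Inf {c. (v, c) \<in> ?G})"
    by (rule continuous_on_lower_boundary[OF closed_feasible_region convex_feasible_region
      nonneg up c0])
  then have "continuous_on {V..} (\<lambda>v. ennreal (Inf {c. (v, c) \<in> ?G}))"
    by (rule continuous_on_ennreal)
  then have cont: "continuous_on {V..} (c_star M X)"
    using c_star_eq by (subst continuous_on_cong[OF refl]) auto
  then have "(c_star M X \<longlongrightarrow> c_star M X V) (at V within {V..})"
    by (simp add: continuous_on_def)
  then show ?thesis
    using c_star_eq cont by (simp add: at_within_Ici_at_right)
qed

end
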